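(* Let $k\ge3$ be an integer. Then the binary linear codes $C_{\mathcal{L}_k^{truc}}$ and $C_{\mathcal{M}_k^{truc}}$ are isodual.
   Context: $C^a_b$ denotes the binomial coefficient; put $N=C^{2k-3}_{k-2}$. $I_p$ is the $p\times p$ identity matrix and $J_p$ is the $p\times p$ all-ones matrix minus $I_p$. If $X$ has $m$ columns and $Y$ is $m\times m$, $X(Y)$ denotes the matrix obtained by pasting $Y$ below $X$. $X\sqcup_0Y$ (resp. $X\sqcup_1Y$) is obtained by placing $Y$ to the right of $X$ with bottom rows aligned and filling the remaining upper right block with zeros (resp. ones), iterated from left to right. For $h\ge1$: $A_h^{-1}$ is the $1\times h$ row of ones, $B_h^{-1}$ is the $1\times h$ row of zeros, and for $j\ge0$, $A_h^{j}=A_h^{j-1}(I_{C^{h+j}_{j+1}})\sqcup_0 A_{h-1}^{j-1}(I_{C^{h-1+j}_{j+1}})\sqcup_0\cdots\sqcup_0A_1^{j-1}(I_{C^{1+j}_{j+1}})$ and $B_h^{j}=B_h^{j-1}(J_{C^{h+j}_{j+1}})\sqcup_1 B_{h-1}^{j-1}(J_{C^{h-1+j}_{j+1}})\sqcup_1\cdots\sqcup_1B_1^{j-1}(J_{C^{1+j}_{j+1}})$. The matrices $A_{k-1}^{k-3}$ and $B_{k-1}^{k-3}$ are square of order $N$. Define $\mathcal{L}_k^{truc}=(I_N\,|\,A_{k-1}^{k-3})$ and $\mathcal{M}_k^{truc}=(J_N\,|\,B_{k-1}^{k-3})$, read over $\mathbb{F}_2$; $C_{\mathcal{L}_k^{truc}}$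 and $C_{\mathcal{M}_k^{truc}}$ are the binary linear codes of length $2N$ generated by the rows of these matrices. A code is isodual if it is equivalent (by a permutation of coordinates) to its dual code. *)

theory Defs
  imports
    "Jordan_Normal_Form.VS_Connect"
    "HOL-Library.Z2"
    "HOL-Combinatorics.Permutations"
begin

definition J_mat :: "nat \<Rightarrow> bit mat"
  where "J_mat p = mat p p (\<lambda>_. 1) - 1\<^sub>m p"

definition append_cols :: "'a mat \<Rightarrow> 'a mat \<Rightarrow> 'a mat"
  where "append_cols X Y = mat (dim_row X) (dim_col X + dim_col Y)
    (\<lambda>(r, s). if s < dim_col X then X $$ (r, s) else Y $$ (r, s - dim_col X))"

text \<open>
  \<open>join_cols c X Y\<close> is \<open>X \<squnion>\<^sub>c Y\<close>: \<open>Y\<close> is placed to the right of \<open>X\<close> with bottom rows aligned, and the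
  remaining upper right block is filled with \<open>c\<close>. It is only meant for \<open>dim_row Y \<le> dim_row X\<close>.
\<close>

definition join_cols :: "'a :: zero \<Rightarrow> 'a mat \<Rightarrow> 'a mat \<Rightarrow> 'a mat"
  where "join_cols c X Y =
    append_cols X (mat (dim_row X - dim_row Y) (dim_col Y) (\<lambda>_. c) @\<^sub>r Y)"

text \<open>
  The upper index of the matrices \<open>A\<^sub>h\<^sup>j\<close> and \<open>B\<^sub>h\<^sup>j\<close> starts at \<open>-1\<close>, so it is shifted by one:
  \<open>A_mat i h\<close> is \<open>A\<^sub>h\<^sup>i\<^sup>-\<^sup>1\<close> and \<open>B_mat i h\<close> is \<open>B\<^sub>h\<^sup>i\<^sup>-\<^sup>1\<close>. In the \<open>Suc\<close> case the upper index of the left-hand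
  side is thus \<open>j = i\<close>, and the blocks run through the lower indices \<open>h, h - 1, \<dots>, 1\<close>.
  The values at \<open>h = 0\<close> have no meaning.
\<close>

primrec A_mat :: "nat \<Rightarrow> nat \<Rightarrow> bit mat" where
  "A_mat 0 = (\<lambda>h. mat 1 h (\<lambda>_. 1))"
| "A_mat (Suc i) = (\<lambda>h. foldl (join_cols 0)
     (A_mat i h @\<^sub>r 1\<^sub>m ((h + i) choose (i + 1)))
     (map (\<lambda>g. A_mat i g @\<^sub>r 1\<^sub>m ((g + i) choose (i + 1))) (rev [1..<h])))"

primrec B_mat :: "nat \<Rightarrow> nat \<Rightarrow> bit mat" where
  "B_mat 0 = (\<lambda>h. mat 1 h (\<lambda>_. 0))"
| "B_mat (Suc i) = (\<lambda>h. foldl (join_cols 1)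
     (B_mat i h @\<^sub>r J_mat ((h + i) choose (i + 1)))
     (map (\<lambda>g. B_mat i g @\<^sub>r J_mat ((g + i) choose (i + 1))) (rev [1..<h])))"

definition N_truc :: "nat \<Rightarrow> nat"
  where "N_truc k = (2 * k - 3) choose (k - 2)"

text \<open>The matrices \<open>A\<close> and \<open>B\<close> with lower index \<open>k - 1\<close> and upper index \<open>k - 3\<close>, shifted to \<open>k - 2\<close>.\<close>

definition L_truc :: "nat \<Rightarrow> bit mat"
  where "L_truc k = append_cols (1\<^sub>m (N_truc k)) (A_mat (k - 2) (k - 1))"

definition M_truc :: "nat \<Rightarrow> bit mat"
  where "M_truc k = append_cols (J_mat (N_truc k)) (B_mat (k - 2) (k - 1))"

definition code_of :: "bit mat \<Rightarrow> bit vec set"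
  where "code_of G = vec_space.row_space (dim_col G) G"

definition dual_code :: "nat \<Rightarrow> bit vec set \<Rightarrow> bit vec set"
  where "dual_code n C = vec_module.orthogonal_complement n C"

definition code_equiv :: "nat \<Rightarrow> bit vec set \<Rightarrow> bit vec set \<Rightarrow> bool"
  where "code_equiv n C D \<longleftrightarrow>
    (\<exists>\<pi>. \<pi> permutes {..<n} \<and> D = (\<lambda>v. vec n (\<lambda>i. v $ \<pi> i)) ` C)"

definition isodual :: "nat \<Rightarrow> bit vec set \<Rightarrow> bool"
  where "isodual n C \<longleftrightarrow> code_equiv n C (dual_code n C)"

end

theory Submission
  imports Defs
begin

text \<open>
  The matrix \<open>A = A_mat (k - 2) (k - 1)\<close> is the inclusion matrix of \<open>(k-2)\<close>-subsets against
  \<open>(k-1)\<close>-subsets of a \<open>(2k-3)\<close>-set. Taking complements shows that it is invariant under reflection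
  in the antidiagonal, and so are \<open>I\<close>, \<open>J\<close> and \<open>B = A + \<one>\<close>, where \<open>\<one>\<close> is the all-ones matrix. For such
  \<open>X\<close> and \<open>Y\<close>, reversing the coordinates maps the code of \<open>(X | Y)\<close> onto \<open>{(Y z, X z)}\<close>. In
  characteristic 2 this lies in the dual code as soon as \<open>X Y = Y X\<close>, and it is the whole dual code if
  every solution of \<open>X a = Y b\<close> has this form. For \<open>(J | B)\<close> this uses that all row and column sums
  of \<open>A\<close> equal \<open>k - 1\<close> and that \<open>N (k - 1)\<close> is even.
\<close>

text \<open>These two rules would turn bit arithmetic into \<open>xor\<close> and \<open>and\<close>, out of reach of the ring lemmas.\<close>

declare add_bit_eq_xor [simp del] mult_bit_eq_and [simp del]

section \<open>Block recursion for the matrices \<open>A_mat\<close>\<close>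

lemma dim_append_cols [simp]:
  "dim_row (append_cols X Y) = dim_row X"
  "dim_col (append_cols X Y) = dim_col X + dim_col Y"
  by (simp_all add: append_cols_def)

lemma dim_append_rows [simp]:
  "dim_row (X @\<^sub>r Y) = dim_row X + dim_row Y"
  "dim_col (X @\<^sub>r Y) = dim_col X"
  by (simp_all add: append_rows_def)

lemma dim_join_cols [simp]:
  "dim_row (join_cols c X Y) = dim_row X"
  "dim_col (join_cols c X Y) = dim_col X + dim_col Y"
  by (simp_all add: join_cols_def)

lemma dim_J_mat [simp]: "dim_row (J_mat p) = p" "dim_col (J_mat p) = p"
  by (simp_all add: J_mat_def)

lemma index_append_rows:
  assumes "r < dim_row X + dim_row Y" "s < dim_col X"
  shows "(X @\<^sub>r Y) $$ (r, s) = (if r < dim_row X then X $$ (r, s) else Y $$ (r - dim_row X, s))"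
  using assms by (simp add: append_rows_def)

lemma index_join_cols:
  assumes "dim_row Y \<le> dim_row X" "r < dim_row X" "s < dim_col X + dim_col Y"
  shows "join_cols c X Y $$ (r, s) =
    (if s < dim_col X then X $$ (r, s)
     else if r < dim_row X - dim_row Y then c
     else Y $$ (r - (dim_row X - dim_row Y), s - dim_col X))"
  using assms by (simp add: join_cols_def append_cols_def index_append_rows)

text \<open>As the heights do not increase, the offsets \<open>dim_row X - dim_row Y\<close> and
  \<open>dim_row Y - dim_row Z\<close> add up to \<open>dim_row X - dim_row Z\<close>.\<close>

lemma join_cols_assoc:
  assumes "dim_row Z \<le> dim_row Y" "dim_row Y \<le> dim_row X"
  shows "join_cols c (join_cols c X Y) Z = join_cols c X (join_cols c Y Z)"
  using assms by (intro eq_matI) (auto simp: index_join_cols diff_diff_left)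

lemma foldl_join_cols_left:
  assumes "dim_row Y \<le> dim_row X" "\<And>Z. Z \<in> set Zs \<Longrightarrow> dim_row Z \<le> dim_row Y"
  shows "foldl (join_cols c) (join_cols c X Y) Zs = join_cols c X (foldl (join_cols c) Y Zs)"
  using assms
proof (induction Zs arbitrary: Y)
  case (Cons Z Zs)
  then show ?case by (simp add: join_cols_assoc)
qed simp

lemma join_cols_empty: "dim_col Y = 0 \<Longrightarrow> join_cols c X Y = X"
  by (intro eq_matI) (auto simp: join_cols_def append_cols_def)

lemma dim_row_foldl_join_cols: "dim_row (foldl (join_cols c) X Ys) = dim_row X"
  by (induction Ys arbitrary: X) simp_all

lemma dim_row_A_mat [simp]: "dim_row (A_mat i h) = (h + i) choose i"
  by (induction i arbitrary: h) (simp_all add: dim_row_foldl_join_cols)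

text \<open>The fold over the blocks after the first is \<open>A_mat (Suc i) h\<close>, and
  associativity pulls the first block out. For \<open>h = 0\<close> that matrix has no
  columns.\<close>

lemma A_mat_Suc_step:
  "A_mat (Suc i) (Suc h) =
    join_cols 0 (A_mat i (Suc h) @\<^sub>r 1\<^sub>m ((Suc h + i) choose (i + 1))) (A_mat (Suc i) h)"
proof (cases h)
  case 0
  have "dim_col (A_mat j 0) = 0" for j
    by (induction j) simp_all
  then show ?thesis
    using 0 by (simp add: join_cols_empty del: A_mat.simps(2)) simp
next
  case (Suc g)
  have "rev [1..<Suc h] = h # rev [1..<h]"
    using Suc by simp
  then have "A_mat (Suc i) (Suc h) = foldl (join_cols 0)
      (join_cols 0 (A_mat i (Suc h) @\<^sub>r 1\<^sub>m ((Suc h + i) choose (i + 1)))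
        (A_mat i h @\<^sub>r 1\<^sub>m ((h + i) choose (i + 1))))
      (map (\<lambda>g. A_mat i g @\<^sub>r 1\<^sub>m ((g + i) choose (i + 1))) (rev [1..<h]))"
    by simp
  also have "\<dots> = join_cols 0 (A_mat i (Suc h) @\<^sub>r 1\<^sub>m ((Suc h + i) choose (i + 1)))
      (A_mat (Suc i) h)"
    unfolding A_mat.simps(2)
    by (rule foldl_join_cols_left) (auto intro!: add_mono binomial_right_mono)
  finally show ?thesis .
qed

lemma dim_col_A_mat [simp]: "dim_col (A_mat i h) = (h + i) choose (i + 1)"
proof (induction i arbitrary: h)
  case 0
  then show ?case by simp
next
  case (Suc i)
  show ?case
  proof (induction h)
    case 0
    then show ?case using Suc by simp
  next
    case (Suc h)
    then show ?case
      using \<open>\<And>h. dim_col (A_mat i h) = (h + i) choose (i + 1)\<close>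
      by (simp add: A_mat_Suc_step del: A_mat.simps(2))
  qed
qed

text \<open>The upper rows and left columns are the sets containing the first element
  \<open>x\<close>. A set without \<open>x\<close> lies in \<open>T \<union> {x}\<close>, which has
  one element more, only if it equals \<open>T\<close>; hence the identity. Its order is the height
  of \<open>A_mat (Suc i) h\<close>, so the fill is exactly the upper right block.\<close>

lemma A_mat_Suc_Suc:
  "A_mat (Suc i) (Suc h) =
    four_block_mat (A_mat i (Suc h)) (0\<^sub>m ((Suc h + i) choose i) ((h + Suc i) choose (Suc i + 1)))
      (1\<^sub>m ((Suc h + i) choose (i + 1))) (A_mat (Suc i) h)"
  unfolding A_mat_Suc_step
  by (intro eq_matI) (auto simp: index_join_cols index_append_rows simp del: A_mat.simps(2))

section \<open>Reflection in the antidiagonal\<close>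

definition anti_transpose :: "'a mat \<Rightarrow> 'a mat"
  where "anti_transpose M = mat (dim_col M) (dim_row M)
    (\<lambda>(r, c). M $$ (dim_row M - 1 - c, dim_col M - 1 - r))"

lemma dim_anti_transpose [simp]:
  "dim_row (anti_transpose M) = dim_col M" "dim_col (anti_transpose M) = dim_row M"
  by (simp_all add: anti_transpose_def)

lemma index_anti_transpose:
  assumes "r < dim_col M" "c < dim_row M"
  shows "anti_transpose M $$ (r, c) = M $$ (dim_row M - 1 - c, dim_col M - 1 - r)"
  using assms by (simp add: anti_transpose_def)

lemma anti_transpose_four_block_mat:
  assumes "dim_row B = dim_row A" "dim_col B = dim_col D"
    "dim_row C = dim_row D" "dim_col C = dim_col A"
  shows "anti_transpose (four_block_mat A B C D) =
    four_block_mat (anti_transpose D) (anti_transpose B) (anti_transpose C) (anti_transpose A)"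
  using assms
  by (intro eq_matI) (auto simp: anti_transpose_def algebra_simps intro!: arg_cong2[of _ _ _ _ "\<lambda>r s. _ $$ (r, s)"])

lemma anti_transpose_one [simp]: "anti_transpose (1\<^sub>m n) = 1\<^sub>m n"
  by (intro eq_matI) (auto simp: anti_transpose_def)

lemma anti_transpose_zero [simp]: "anti_transpose (0\<^sub>m m n) = 0\<^sub>m n m"
  by (intro eq_matI) (auto simp: anti_transpose_def)

lemma A_mat_1_right: "A_mat i (Suc 0) = mat (Suc i) 1 (\<lambda>_. 1)"
proof (induction i)
  case (Suc i)
  then show ?case
    by (intro eq_matI) (auto simp: index_append_rows)
qed simp

text \<open>
  The rows of \<open>A_mat i h\<close> are the \<open>i\<close>-subsets and its columns the \<open>(i+1)\<close>-subsets of an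
  \<open>(h+i)\<close>-set, in lexicographic order, and its entries record inclusion. Complementation reverses
  both the inclusions and the lexicographic order.
\<close>

lemma anti_transpose_A_mat: "anti_transpose (A_mat i (Suc h)) = A_mat h (Suc i)"
proof (induction "i + h" arbitrary: i h)
  case 0
  then show ?case
    by (intro eq_matI) (auto simp: anti_transpose_def)
next
  case (Suc n)
  consider "i = 0" | "h = 0" | i' h' where "i = Suc i'" "h = Suc h'"
    by (cases i; cases h) auto
  then show ?case
  proof cases
    case 1
    then show ?thesis
      by (intro eq_matI) (auto simp: anti_transpose_def A_mat_1_right)
  next
    case 2
    then show ?thesis
      by (intro eq_matI) (auto simp: anti_transpose_def A_mat_1_right)
  next
    case 3
    \<comment> \<open>Reflection swaps the two diagonal blocks, which have \<open>i\<close> or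
      \<open>h\<close> lowered by one.\<close>
    have IH1: "anti_transpose (A_mat i' (Suc h)) = A_mat h (Suc i')"
      and IH2: "anti_transpose (A_mat i (Suc h')) = A_mat h' (Suc i)"
      using Suc 3 by (auto simp del: A_mat.simps(2))
    \<comment> \<open>Complementary binomial coefficients match the sizes of the identity and zero
      blocks.\<close>
    have sym: "(i' + Suc (Suc h')) choose a = (h' + Suc (Suc i')) choose b"
      if "a + b = i' + h' + 2" for a b
    proof -
      have "i' + Suc (Suc h') = a + b" "h' + Suc (Suc i') = a + b"
        using that by simp_all
      then show ?thesis
        using binomial_symmetric[of a "a + b"] by (simp only: add_diff_cancel_left')
    qed
    show ?thesis
      using IH1 IH2 sym[of "Suc i'" "Suc h'"] sym[of i' "Suc (Suc h')"] sym[of "Suc (Suc i')" h']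
      unfolding 3
      by (simp add: A_mat_Suc_Suc[of i' "Suc h'"] A_mat_Suc_Suc[of h' "Suc i'"]
          anti_transpose_four_block_mat ac_simps del: A_mat.simps(2) binomial_Suc_Suc)
  qed
qed

section \<open>The matrices \<open>B_mat\<close> as complements of \<open>A_mat\<close>\<close>

lemma map_mat_join_cols:
  assumes "dim_row Y \<le> dim_row X"
  shows "map_mat f (join_cols c X Y) = join_cols (f c) (map_mat f X) (map_mat f Y)"
  using assms by (intro eq_matI) (auto simp: index_join_cols)

lemma map_mat_append_rows:
  assumes "dim_col Y = dim_col X"
  shows "map_mat f (X @\<^sub>r Y) = map_mat f X @\<^sub>r map_mat f Y"
  using assms by (intro eq_matI) (auto simp: index_append_rows)

lemma map_mat_foldl_join_cols:
  assumes "\<And>Y. Y \<in> set Ys \<Longrightarrow> dim_row Y \<le> dim_row X"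
  shows "map_mat f (foldl (join_cols c) X Ys) =
    foldl (join_cols (f c)) (map_mat f X) (map (map_mat f) Ys)"
  using assms by (induction Ys arbitrary: X) (simp_all add: map_mat_join_cols)

text \<open>In characteristic 2, subtracting the identity is the same as adding it.\<close>

lemma J_mat_eq: "J_mat p = map_mat ((+) 1) (1\<^sub>m p)"
  by (intro eq_matI) (auto simp: J_mat_def)

text \<open>Complementing exchanges the fills 0 and 1 and the blocks \<open>I\<close> and
  \<open>J\<close>, so it carries one recursion into the other.\<close>

lemma B_mat_eq: "B_mat i h = map_mat ((+) 1) (A_mat i h)"
proof (induction i arbitrary: h)
  case 0
  show ?case by (intro eq_matI) auto
next
  case (Suc i)
  have "map_mat ((+) 1) (A_mat (Suc i) h) = foldl (join_cols (1 + 0))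
     (map_mat ((+) 1) (A_mat i h @\<^sub>r 1\<^sub>m ((h + i) choose (i + 1))))
     (map (map_mat ((+) 1))
       (map (\<lambda>g. A_mat i g @\<^sub>r 1\<^sub>m ((g + i) choose (i + 1))) (rev [1..<h])))"
    unfolding A_mat.simps(2)
    by (rule map_mat_foldl_join_cols) (auto intro!: add_mono binomial_right_mono)
  then show ?case
    by (simp add: Suc map_mat_append_rows J_mat_eq comp_def del: A_mat.simps(2))
qed

section \<open>Row sums modulo 2\<close>

lemma sum_lessThan_add:
  fixes f :: "nat \<Rightarrow> 'a :: comm_monoid_add"
  shows "(\<Sum>c<m + n. f c) = (\<Sum>c<m. f c) + (\<Sum>c<n. f (m + c))"
  by (induction n) (simp_all add: add.assoc)

text \<open>An \<open>i\<close>-subset of an \<open>(h+i)\<close>-set lies in exactly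
  \<open>h\<close> subsets of size \<open>i+1\<close>. In block form, an upper row inherits its sum
  from the left block; a lower row gets 1 from the identity and the rest from the right
  block.\<close>

lemma row_sum_A_mat:
  assumes "r < dim_row (A_mat i h)"
  shows "(\<Sum>c<dim_col (A_mat i h). A_mat i h $$ (r, c)) = of_nat h"
  using assms
proof (induction i arbitrary: h r)
  case 0
  then show ?case by simp
next
  case (Suc i)
  note IH_i = Suc.IH
  show ?case
    using Suc.prems
  proof (induction h arbitrary: r)
    case 0
    then show ?case by (simp add: binomial_eq_0 del: A_mat.simps(2) binomial_Suc_Suc)
  next
    case (Suc h)
    show ?case
    proof (cases "r < dim_row (A_mat i (Suc h))")
      case True
      then show ?thesis
        using IH_i[OF True]
        by (simp add: A_mat_Suc_Suc sum_lessThan_add del: A_mat.simps(2) binomial_Suc_Suc)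
    next
      case False
      define s where "s = r - dim_row (A_mat i (Suc h))"
      have s: "s < dim_row (A_mat (Suc i) h)" "r = dim_row (A_mat i (Suc h)) + s"
        "dim_row (A_mat (Suc i) h) = dim_col (A_mat i (Suc h))"
        using False Suc.prems by (auto simp: s_def simp del: A_mat.simps(2))
      then have one: "(\<Sum>c<dim_col (A_mat i (Suc h)). 1\<^sub>m (dim_col (A_mat i (Suc h))) $$ (s, c)) = (1 :: bit)"
        by (simp add: if_distrib sum.delta cong: if_cong)
      show ?thesis
        using Suc.IH[OF s(1)] s one
        by (simp add: A_mat_Suc_Suc sum_lessThan_add del: A_mat.simps(2) dim_row_A_mat)
    qed
  qed
qed

section \<open>Reversal of vectors and products with pasted matrices\<close>

definition rev_vec :: "'a vec \<Rightarrow> 'a vec"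
  where "rev_vec v = vec (dim_vec v) (\<lambda>i. v $ (dim_vec v - 1 - i))"

lemma dim_rev_vec [simp]: "dim_vec (rev_vec v) = dim_vec v"
  by (simp add: rev_vec_def)

lemma rev_vec_carrier [simp]: "v \<in> carrier_vec n \<Longrightarrow> rev_vec v \<in> carrier_vec n"
  by (rule carrier_vecI) (simp add: carrier_vecD)

lemma rev_rev_vec [simp]: "rev_vec (rev_vec v) = v"
  by (intro eq_vecI) (auto simp: rev_vec_def)

lemma rev_append_vec: "rev_vec (u @\<^sub>v v) = rev_vec v @\<^sub>v rev_vec u"
  by (intro eq_vecI) (auto simp: rev_vec_def)

lemma index_mult_mat_vec_sum:
  assumes "i < dim_row M" "v \<in> carrier_vec (dim_col M)"
  shows "(M *\<^sub>v v) $ i = (\<Sum>j<dim_col M. M $$ (i, j) * v $ j)"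
  using assms by (simp add: scalar_prod_def lessThan_atLeast0)

text \<open>With \<open>R\<close> the reversal matrices of fitting sizes,
  \<open>anti_transpose M\<close> is \<open>R M\<^sup>T R\<close>, and
  \<open>R R = I\<close>.\<close>

lemma rev_vec_transpose_mult:
  assumes "y \<in> carrier_vec (dim_row M)"
  shows "rev_vec (M\<^sup>T *\<^sub>v y) = anti_transpose M *\<^sub>v rev_vec y"
proof (rule eq_vecI)
  fix i
  assume "i < dim_vec (anti_transpose M *\<^sub>v rev_vec y)"
  then have i: "i < dim_col M" by simp
  have "(anti_transpose M *\<^sub>v rev_vec y) $ i =
      (\<Sum>j<dim_row M. anti_transpose M $$ (i, j) * rev_vec y $ j)"
    using i assms by (subst index_mult_mat_vec_sum) auto
  also have "\<dots> = (\<Sum>j<dim_row M. M $$ (dim_row M - Suc j, dim_col M - 1 - i) * y $ (dim_row M - Suc j))"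
    using i assms by (intro sum.cong) (auto simp: anti_transpose_def rev_vec_def)
  also have "\<dots> = (\<Sum>j<dim_row M. M $$ (j, dim_col M - 1 - i) * y $ j)"
    by (rule sum.nat_diff_reindex)
  also have "\<dots> = (M\<^sup>T *\<^sub>v y) $ (dim_col M - 1 - i)"
    using i assms by (subst index_mult_mat_vec_sum) auto
  also have "\<dots> = rev_vec (M\<^sup>T *\<^sub>v y) $ i"
    using i by (simp add: rev_vec_def)
  finally show "rev_vec (M\<^sup>T *\<^sub>v y) $ i = (anti_transpose M *\<^sub>v rev_vec y) $ i" by simp
qed simp

lemma transpose_append_cols_mult_vec:
  assumes "dim_row Y = dim_row X"
  shows "(append_cols X Y)\<^sup>T *\<^sub>v y = (X\<^sup>T *\<^sub>v y) @\<^sub>v (Y\<^sup>T *\<^sub>v y)"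
proof (rule eq_vecI)
  fix i
  assume "i < dim_vec ((X\<^sup>T *\<^sub>v y) @\<^sub>v (Y\<^sup>T *\<^sub>v y))"
  moreover from this have "col (append_cols X Y) i =
      (if i < dim_col X then col X i else col Y (i - dim_col X))"
    using assms by (intro eq_vecI) (auto simp: append_cols_def)
  ultimately show "((append_cols X Y)\<^sup>T *\<^sub>v y) $ i = ((X\<^sup>T *\<^sub>v y) @\<^sub>v (Y\<^sup>T *\<^sub>v y)) $ i"
    by auto
qed simp

lemma append_cols_mult_append_vec:
  assumes "X \<in> carrier_mat m p" "Y \<in> carrier_mat m q" "a \<in> carrier_vec p" "b \<in> carrier_vec q"
  shows "append_cols X Y *\<^sub>v (a @\<^sub>v b) = X *\<^sub>v a + Y *\<^sub>v b"
proof (rule eq_vecI)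
  fix i
  assume i: "i < dim_vec (X *\<^sub>v a + Y *\<^sub>v b)"
  then have "row (append_cols X Y) i = row X i @\<^sub>v row Y i"
    using assms by (intro eq_vecI) (auto simp: append_cols_def)
  then show "(append_cols X Y *\<^sub>v (a @\<^sub>v b)) $ i = (X *\<^sub>v a + Y *\<^sub>v b) $ i"
    using i assms by (auto simp: scalar_prod_append[of _ p _ q])
qed (use assms in auto)

section \<open>Codes as images and dual codes as kernels\<close>

lemma code_of_eq: "code_of G = (\<lambda>y. G\<^sup>T *\<^sub>v y) ` carrier_vec (dim_row G)"
proof -
  have "G\<^sup>T *\<^sub>v y \<in> carrier_vec (dim_col G)" for y
    by (rule carrier_vecI) simp
  moreover have "G \<in> carrier_mat (dim_row G) (dim_col G)"
    by (rule carrier_matI) simp_all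
  ultimately show ?thesis
    unfolding code_of_def by (subst vec_space.row_space_eq[of G "dim_row G"]) blast+
qed

text \<open>Orthogonality of \<open>w\<close> to \<open>G\<^sup>T y\<close> means
  \<open>y \<bullet> G w = 0\<close>; unit vectors \<open>y\<close> then give each coordinate of
  \<open>G w\<close>.\<close>

lemma dual_code_of_eq:
  "dual_code (dim_col G) (code_of G) =
    {w \<in> carrier_vec (dim_col G). G *\<^sub>v w = 0\<^sub>v (dim_row G)}"
proof -
  have "(\<forall>y\<in>carrier_vec (dim_row G). w \<bullet> (G\<^sup>T *\<^sub>v y) = 0) \<longleftrightarrow> G *\<^sub>v w = 0\<^sub>v (dim_row G)"
    if w: "w \<in> carrier_vec (dim_col G)" for w
  proof -
    have eq: "w \<bullet> (G\<^sup>T *\<^sub>v y) = y \<bullet> (G *\<^sub>v w)" if y: "y \<in> carrier_vec (dim_row G)" for y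
    proof -
      have "G\<^sup>T *\<^sub>v y \<in> carrier_vec (dim_col G)"
        by (rule carrier_vecI) simp
      then have "w \<bullet> (G\<^sup>T *\<^sub>v y) = (G\<^sup>T *\<^sub>v y) \<bullet> w"
        by (rule comm_scalar_prod[OF w])
      also have "\<dots> = y \<bullet> (G *\<^sub>v w)"
        by (rule transpose_vec_mult_scalar[OF carrier_matI[OF refl refl] w y])
      finally show ?thesis .
    qed
    show ?thesis
    proof
      assume *: "\<forall>y\<in>carrier_vec (dim_row G). w \<bullet> (G\<^sup>T *\<^sub>v y) = 0"
      show "G *\<^sub>v w = 0\<^sub>v (dim_row G)"
      proof (rule eq_vecI)
        fix i
        assume i: "i < dim_vec (0\<^sub>v (dim_row G) :: bit vec)"
        then have "unit_vec (dim_row G) i \<bullet> (G *\<^sub>v w) = 0"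
          using * eq[of "unit_vec (dim_row G) i"] by simp
        moreover have "unit_vec (dim_row G) i \<bullet> (G *\<^sub>v w) = (G *\<^sub>v w) $ i"
          by (rule scalar_prod_left_unit[OF carrier_vecI]) (use i in simp_all)
        ultimately show "(G *\<^sub>v w) $ i = 0\<^sub>v (dim_row G) $ i"
          using i by simp
      qed simp
    next
      assume "G *\<^sub>v w = 0\<^sub>v (dim_row G)"
      then show "\<forall>y\<in>carrier_vec (dim_row G). w \<bullet> (G\<^sup>T *\<^sub>v y) = 0"
        using eq by simp
    qed
  qed
  then show ?thesis
    unfolding dual_code_def vec_module.orthogonal_complement_def code_of_eq by auto
qed

section \<open>A criterion for isoduality\<close>

lemma bit_add_eq_0_iff: "a + b = 0 \<longleftrightarrow> a = b" for a b :: bit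
  by (cases a; cases b) simp_all

text \<open>
  The coordinate permutation is the reversal of \<open>{..<2 * n}\<close>. It turns a codeword
  \<open>(X\<^sup>T y, Y\<^sup>T y)\<close> into \<open>(Y z, X z)\<close>, where \<open>z\<close> is the reversal of \<open>y\<close>.
\<close>

lemma isodual_append_cols:
  assumes X: "X \<in> carrier_mat n n" "anti_transpose X = X"
    and Y: "Y \<in> carrier_mat n n" "anti_transpose Y = Y"
    and ker: "\<And>a b. a \<in> carrier_vec n \<Longrightarrow> b \<in> carrier_vec n \<Longrightarrow>
      X *\<^sub>v a = Y *\<^sub>v b \<longleftrightarrow> (\<exists>z\<in>carrier_vec n. a = Y *\<^sub>v z \<and> b = X *\<^sub>v z)"
  shows "isodual (2 * n) (code_of (append_cols X Y))"
proof -
  define G where "G = append_cols X Y"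
  \<comment> \<open>The identity outside \<open>{..<2 * n}\<close>, as \<open>permutes\<close>
    demands, and an involution, hence its own inverse in the bijectivity proof.\<close>
  define \<pi> where "\<pi> i = (if i < 2 * n then 2 * n - 1 - i else i)" for i :: nat
  have dim: "dim_row G = n" "dim_col G = 2 * n"
    using X Y by (auto simp: G_def)
  have "bij_betw \<pi> {..<2 * n} {..<2 * n}"
    by (rule bij_betw_byWitness[where f' = \<pi>]) (auto simp: \<pi>_def)
  then have "\<pi> permutes {..<2 * n}"
    by (rule bij_imp_permutes) (simp add: \<pi>_def)
  moreover have "dual_code (2 * n) (code_of G) = (\<lambda>v. vec (2 * n) (\<lambda>i. v $ \<pi> i)) ` code_of G"
  proof -
    have GT: "G\<^sup>T *\<^sub>v y \<in> carrier_vec (2 * n)" for y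
      by (rule carrier_vecI) (simp add: dim(2))
    have "vec (2 * n) (\<lambda>i. v $ \<pi> i) = rev_vec v" if "v \<in> carrier_vec (2 * n)" for v :: "bit vec"
      using that by (intro eq_vecI) (simp_all add: rev_vec_def \<pi>_def)
    then have "(\<lambda>v. vec (2 * n) (\<lambda>i. v $ \<pi> i)) ` code_of G =
        (\<lambda>y. rev_vec (G\<^sup>T *\<^sub>v y)) ` carrier_vec n"
      unfolding code_of_eq image_image dim(1) using GT by (intro image_cong) simp_all
    also have "\<dots> = (\<lambda>y. (Y *\<^sub>v rev_vec y) @\<^sub>v (X *\<^sub>v rev_vec y)) ` carrier_vec n"
    proof (rule image_cong[OF refl])
      fix y :: "bit vec"
      assume y: "y \<in> carrier_vec n"
      show "rev_vec (G\<^sup>T *\<^sub>v y) = (Y *\<^sub>v rev_vec y) @\<^sub>v (X *\<^sub>v rev_vec y)"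
        using X Y y
        by (simp add: G_def transpose_append_cols_mult_vec rev_append_vec rev_vec_transpose_mult)
    qed
    also have "\<dots> = (\<lambda>z. (Y *\<^sub>v z) @\<^sub>v (X *\<^sub>v z)) ` rev_vec ` carrier_vec n"
      by (simp add: image_image)
    also have "rev_vec ` carrier_vec n = (carrier_vec n :: bit vec set)"
    proof -
      have "v \<in> rev_vec ` carrier_vec n" if "v \<in> carrier_vec n" for v :: "bit vec"
        by (rule image_eqI[of _ _ "rev_vec v"]) (use that in simp_all)
      then show ?thesis by auto
    qed
    also have "(\<lambda>z. (Y *\<^sub>v z) @\<^sub>v (X *\<^sub>v z)) ` carrier_vec n =
        {w \<in> carrier_vec (2 * n). G *\<^sub>v w = 0\<^sub>v n}" (is "?L = ?R")
    proof -
      \<comment> \<open>In characteristic 2 the parity check \<open>X a + Y b = 0\<close> reads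
        \<open>X a = Y b\<close>, the equation that \<open>ker\<close> solves.\<close>
      have zero: "G *\<^sub>v (a @\<^sub>v b) = 0\<^sub>v n \<longleftrightarrow> X *\<^sub>v a = Y *\<^sub>v b"
        if "a \<in> carrier_vec n" "b \<in> carrier_vec n" for a b
        using that X Y
        by (auto simp: G_def append_cols_mult_append_vec[of X n n Y n] vec_eq_iff bit_add_eq_0_iff)
      show ?thesis
      proof (intro equalityI subsetI)
        fix w
        assume "w \<in> ?L"
        then obtain z where z: "z \<in> carrier_vec n" "w = (Y *\<^sub>v z) @\<^sub>v (X *\<^sub>v z)" by auto
        then show "w \<in> ?R"
          using X Y ker[of "Y *\<^sub>v z" "X *\<^sub>v z"] zero[of "Y *\<^sub>v z" "X *\<^sub>v z"]
          by (auto simp: mult_2)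
      next
        fix w
        assume w: "w \<in> ?R"
        define a b where "a = vec_first w n" and "b = vec_last w n"
        have "w \<in> carrier_vec (n + n)"
          using w by (simp add: mult_2)
        then have ab: "a \<in> carrier_vec n" "b \<in> carrier_vec n" "w = a @\<^sub>v b"
          by (simp_all add: a_def b_def)
        have "G *\<^sub>v (a @\<^sub>v b) = 0\<^sub>v n"
          using w ab(3) by simp
        then obtain z where "z \<in> carrier_vec n" "a = Y *\<^sub>v z" "b = X *\<^sub>v z"
          using zero[OF ab(1,2)] ker[OF ab(1,2)] by blast
        then show "w \<in> ?L"
          using ab(3) by blast
      qed
    qed
    also have "\<dots> = dual_code (2 * n) (code_of G)"
      using dual_code_of_eq[of G] by (simp add: dim)
    finally show ?thesis by simp
  qed
  ultimately show ?thesis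
    unfolding isodual_def code_equiv_def G_def by blast
qed

text \<open>With \<open>X\<close> the identity the kernel equation is \<open>a = A b\<close>, solved
  by \<open>z = b\<close>.\<close>

lemma isodual_one_append_cols:
  assumes "A \<in> carrier_mat n n" "anti_transpose A = A"
  shows "isodual (2 * n) (code_of (append_cols (1\<^sub>m n) A))"
proof (rule isodual_append_cols)
  show "1\<^sub>m n *\<^sub>v a = A *\<^sub>v b \<longleftrightarrow> (\<exists>z\<in>carrier_vec n. a = A *\<^sub>v z \<and> b = 1\<^sub>m n *\<^sub>v z)"
    if "a \<in> carrier_vec n" "b \<in> carrier_vec n" for a b
    using that by (metis one_mult_mat_vec)
qed (use assms in simp_all)

text \<open>
  Here \<open>m\<close> is the order and \<open>d\<close> the row sum of \<open>A\<close> modulo 2, while \<open>p\<close> and \<open>q\<close> are the coordinate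
  sums of \<open>a\<close> and \<open>b\<close> in \<open>J a = B b\<close>. The solution is \<open>z = b + t \<one>\<close>, for if \<open>m = 1\<close> then \<open>q = 0\<close>.
\<close>

lemma bit_kernel_solution:
  fixes m d p q x y t :: bit
  assumes "p + x = q + y" "m * p + p = m * q + d * q" "m * d = 0" "t = (if m = 0 then q else p)"
  shows "x = m * t + q + (d * t + y)" "b = m * t + q + (t + b)"
  using assms by (cases m; cases d; cases p; cases q; cases x; cases y; cases b; simp)+

text \<open>With \<open>s\<close> the coordinate sum, the two blocks map \<open>a\<close> to
  \<open>s(a) \<one> + a\<close> and \<open>s(a) \<one> + A a\<close>. Since
  \<open>A \<one> = d \<one>\<close> and \<open>s(A a) = d s(a)\<close>, the kernel condition
  becomes a computation with single bits.\<close>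

lemma isodual_complement:
  fixes A :: "bit mat"
  assumes A: "A \<in> carrier_mat n n" "anti_transpose A = A"
    and row_sum: "\<And>r. r < n \<Longrightarrow> (\<Sum>c<n. A $$ (r, c)) = d"
    and even: "of_nat n * d = 0"
  shows "isodual (2 * n) (code_of (append_cols (J_mat n) (map_mat ((+) 1) A)))"
proof (rule isodual_append_cols)
  define s where "s a = (\<Sum>j<n. a $ j)" for a :: "bit vec"
  let ?B = "map_mat ((+) 1) A"
  have J: "(J_mat n *\<^sub>v a) $ i = s a + a $ i" if "a \<in> carrier_vec n" "i < n" for a i
  proof -
    have "(J_mat n *\<^sub>v a) $ i = (\<Sum>j<n. (1 + (if i = j then 1 else 0)) * a $ j)"
      using that by (subst index_mult_mat_vec_sum) (auto simp: J_mat_eq intro!: sum.cong)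
    also have "\<dots> = (\<Sum>j<n. a $ j + (if i = j then a $ j else 0))"
      by (intro sum.cong) auto
    finally show ?thesis
      using that by (simp add: sum.distrib s_def)
  qed
  have B: "(?B *\<^sub>v a) $ i = s a + (A *\<^sub>v a) $ i" if "a \<in> carrier_vec n" "i < n" for a i
  proof -
    have "(?B *\<^sub>v a) $ i = (\<Sum>j<n. (1 + A $$ (i, j)) * a $ j)"
      using that A by (subst index_mult_mat_vec_sum) (auto intro!: sum.cong)
    also have "\<dots> = s a + (\<Sum>j<n. A $$ (i, j) * a $ j)"
      by (simp add: distrib_right sum.distrib s_def)
    also have "(\<Sum>j<n. A $$ (i, j) * a $ j) = (A *\<^sub>v a) $ i"
      using that A by (subst index_mult_mat_vec_sum) auto
    finally show ?thesis .
  qed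
  \<comment> \<open>By the antidiagonal symmetry, column \<open>c\<close> is row
    \<open>n - 1 - c\<close> read backwards.\<close>
  have col_sum: "(\<Sum>r<n. A $$ (r, c)) = d" if "c < n" for c
  proof -
    have "A $$ (r, c) = A $$ (n - 1 - c, n - Suc r)" if "r < n" for r
      using index_anti_transpose[of r A c] A \<open>c < n\<close> that by simp
    then have "(\<Sum>r<n. A $$ (r, c)) = (\<Sum>r<n. A $$ (n - 1 - c, n - Suc r))"
      by (intro sum.cong) auto
    also have "\<dots> = (\<Sum>r<n. A $$ (n - 1 - c, r))"
      by (rule sum.nat_diff_reindex)
    finally show ?thesis using that by (simp add: row_sum)
  qed
  have sA: "s (A *\<^sub>v a) = d * s a" if "a \<in> carrier_vec n" for a
  proof -
    have "s (A *\<^sub>v a) = (\<Sum>i<n. \<Sum>j<n. A $$ (i, j) * a $ j)"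
      unfolding s_def using that A
      by (intro sum.cong refl, subst index_mult_mat_vec_sum) auto
    also have "\<dots> = (\<Sum>j<n. (\<Sum>i<n. A $$ (i, j)) * a $ j)"
      by (subst sum.swap) (simp add: sum_distrib_right)
    also have "\<dots> = d * s a"
      by (simp add: col_sum s_def sum_distrib_left)
    finally show ?thesis .
  qed
  have s_add: "s (vec n (\<lambda>i. t + f i)) = of_nat n * t + sum f {..<n}" for t f
    by (simp add: s_def sum.distrib)
  have A_add: "(A *\<^sub>v vec n (\<lambda>i. t + a $ i)) $ i = d * t + (A *\<^sub>v a) $ i"
    if "a \<in> carrier_vec n" "i < n" for t a i
  proof -
    have "(A *\<^sub>v vec n (\<lambda>i. t + a $ i)) $ i = (\<Sum>j<n. A $$ (i, j) * (t + a $ j))"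
      using that A by (subst index_mult_mat_vec_sum) auto
    also have "\<dots> = (\<Sum>j<n. A $$ (i, j)) * t + (\<Sum>j<n. A $$ (i, j) * a $ j)"
      by (simp add: distrib_left sum.distrib sum_distrib_right)
    also have "(\<Sum>j<n. A $$ (i, j) * a $ j) = (A *\<^sub>v a) $ i"
      using that A by (subst index_mult_mat_vec_sum) auto
    finally show ?thesis using that by (simp add: row_sum)
  qed
  show "J_mat n \<in> carrier_mat n n" "?B \<in> carrier_mat n n"
    using A by (auto intro!: carrier_matI)
  have anti_map: "anti_transpose (map_mat f M) = map_mat f (anti_transpose M)" for f and M :: "bit mat"
    by (intro eq_matI) (auto simp: anti_transpose_def)
  show "anti_transpose (J_mat n) = J_mat n" "anti_transpose ?B = ?B"
    using A by (simp_all add: J_mat_eq anti_map)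
  fix a b :: "bit vec"
  assume a: "a \<in> carrier_vec n" and b: "b \<in> carrier_vec n"
  have iff: "J_mat n *\<^sub>v a = ?B *\<^sub>v b \<longleftrightarrow> (\<forall>i<n. s a + a $ i = s b + (A *\<^sub>v b) $ i)"
    using A a b by (auto simp: vec_eq_iff J B simp del: index_mult_mat_vec)
  have Jv: "J_mat n *\<^sub>v z = vec n (\<lambda>i. s z + z $ i)" if "z \<in> carrier_vec n" for z
    using that by (intro eq_vecI) (simp_all add: J del: index_mult_mat_vec)
  have Bv: "?B *\<^sub>v z = vec n (\<lambda>i. s z + (A *\<^sub>v z) $ i)" if "z \<in> carrier_vec n" for z
    using A that by (intro eq_vecI) (simp_all add: B del: index_mult_mat_vec)
  show "J_mat n *\<^sub>v a = ?B *\<^sub>v b \<longleftrightarrow>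
    (\<exists>z\<in>carrier_vec n. a = ?B *\<^sub>v z \<and> b = J_mat n *\<^sub>v z)"
  proof
    assume "\<exists>z\<in>carrier_vec n. a = ?B *\<^sub>v z \<and> b = J_mat n *\<^sub>v z"
    then obtain z where z: "z \<in> carrier_vec n"
      and ab: "a = vec n (\<lambda>i. s z + (A *\<^sub>v z) $ i)" "b = vec n (\<lambda>i. s z + z $ i)"
      using Jv Bv by blast
    \<comment> \<open>These sums turn both sides of \<open>iff\<close> into
      \<open>n s(z) + s(z) + d s(z) + (A z) $ i\<close>.\<close>
    have "s a = of_nat n * s z + d * s z" "s b = of_nat n * s z + s z"
      using sA[OF z] by (simp_all add: ab s_add flip: s_def)
    moreover have "(A *\<^sub>v b) $ i = d * s z + (A *\<^sub>v z) $ i" if "i < n" for i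
      unfolding ab using A_add[OF z that] .
    ultimately show "J_mat n *\<^sub>v a = ?B *\<^sub>v b"
      unfolding iff by (simp add: ab algebra_simps del: index_mult_mat_vec)
  next
    assume "J_mat n *\<^sub>v a = ?B *\<^sub>v b"
    then have ab: "s a + a $ i = s b + (A *\<^sub>v b) $ i" if "i < n" for i
      using iff that by blast
    \<comment> \<open>Summing the equation over all coordinates gives a second relation between
      \<open>s a\<close> and \<open>s b\<close>.\<close>
    then have "s (vec n (\<lambda>i. s a + a $ i)) = s (vec n (\<lambda>i. s b + (A *\<^sub>v b) $ i))"
      by (intro arg_cong[of _ _ s] eq_vecI) auto
    then have sab: "of_nat n * s a + s a = of_nat n * s b + d * s b"
      using sA[OF b] by (simp add: s_add flip: s_def)
    \<comment> \<open>The equation \<open>b = J z\<close> asks for \<open>(n + 1) t = s(b)\<close>.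
      For even \<open>n\<close> this gives \<open>t = s(b)\<close>. For odd \<open>n\<close>,
      \<open>even\<close> yields \<open>d = 0\<close> and \<open>sab\<close> yields
      \<open>s(b) = 0\<close>; then \<open>a = B z\<close> asks for \<open>t = s(a)\<close>.\<close>
    define t where "t = (if of_nat n = (0 :: bit) then s b else s a)"
    define z where "z = vec n (\<lambda>i. t + b $ i)"
    have z: "z \<in> carrier_vec n" "s z = of_nat n * t + s b"
      by (simp_all add: z_def s_add flip: s_def)
    have Az: "(A *\<^sub>v z) $ i = d * t + (A *\<^sub>v b) $ i" if "i < n" for i
      unfolding z_def using A_add[OF b that] .
    have "a $ i = s z + (A *\<^sub>v z) $ i" if "i < n" for i
      unfolding z(2) Az[OF that] using bit_kernel_solution(1)[OF ab[OF that] sab even t_def] .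
    moreover have "b $ i = s z + z $ i" if "i < n" for i
    proof -
      have "z $ i = t + b $ i"
        using that by (simp add: z_def)
      then show ?thesis
        unfolding z(2) using bit_kernel_solution(2)[OF ab[OF that] sab even t_def] by simp
    qed
    ultimately show "\<exists>z\<in>carrier_vec n. a = ?B *\<^sub>v z \<and> b = J_mat n *\<^sub>v z"
      using a b z(1) by (intro bexI[of _ z]) (auto simp: Jv Bv intro!: eq_vecI simp del: index_mult_mat_vec)
  qed
qed

section \<open>Parity of the middle binomial coefficients, and the two codes\<close>

text \<open>The product equals \<open>(2m-1) C(2m-2, m-1)\<close>, and the central coefficient
  \<open>C(2m-2, m-1)\<close> is twice \<open>C(2m-3, m-2)\<close>.\<close>

lemma even_mult_binomial_middle:
  assumes "m \<ge> 2"
  shows "even (((2 * m - 1) choose (m - 1)) * m)"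
proof -
  obtain p where m: "m = p + 2"
    using assms by (metis add.commute le_Suc_ex)
  have "Suc (Suc p) * (Suc (2 * p + 2) choose Suc (Suc p)) = Suc (2 * p + 2) * ((2 * p + 2) choose Suc p)"
    by (rule Suc_times_binomial)
  moreover have "(2 * p + 2) choose Suc p = 2 * ((2 * p + 1) choose p)"
    using binomial_symmetric[of p "2 * p + 1"] by simp
  moreover have "Suc (2 * p + 2) choose Suc (Suc p) = Suc (2 * p + 2) choose Suc p"
    using binomial_symmetric[of "Suc p" "Suc (2 * p + 2)"] by simp
  ultimately show ?thesis
    unfolding m by (simp add: mult.commute del: binomial_Suc_Suc)
qed

theorem lemma7p5:
  fixes k :: nat
  assumes "k \<ge> 3"
  shows "isodual (2 * N_truc k) (code_of (L_truc k)) \<and>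
    isodual (2 * N_truc k) (code_of (M_truc k))"
proof -
  \<comment> \<open>The matrix becomes \<open>A_mat h (Suc h)\<close>, the case \<open>i = h\<close>
    in which \<open>anti_transpose_A_mat\<close> gives back the same matrix.\<close>
  define h where "h = k - 2"
  have h: "k - 2 = h" "k - 1 = Suc h" "2 * k - 3 = Suc h + h" "h \<ge> 1"
    using assms by (auto simp: h_def)
  let ?A = "A_mat h (Suc h)"
  have N: "N_truc k = (Suc h + h) choose h"
    by (simp add: N_truc_def h)
  have A: "?A \<in> carrier_mat (N_truc k) (N_truc k)" "anti_transpose ?A = ?A"
    using binomial_symmetric[of h "Suc h + h"]
    by (auto intro!: carrier_matI simp: N anti_transpose_A_mat
        simp del: A_mat.simps(2) binomial_Suc_Suc)
  have "isodual (2 * N_truc k) (code_of (L_truc k))"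
    unfolding L_truc_def h using A by (rule isodual_one_append_cols)
  moreover have "isodual (2 * N_truc k) (code_of (M_truc k))"
    unfolding M_truc_def h B_mat_eq using A
  proof (rule isodual_complement)
    show "(\<Sum>c<N_truc k. ?A $$ (r, c)) = of_nat (Suc h)" if "r < N_truc k" for r
      using row_sum_A_mat[of r h "Suc h", unfolded carrier_matD[OF A(1)], OF that] .
    \<comment> \<open>\<open>Suc h = k - 1\<close> is at least 2 because
      \<open>k \<ge> 3\<close>.\<close>
    have "even (N_truc k * Suc h)"
      using even_mult_binomial_middle[of "Suc h"] h(4) by (simp add: N mult_2 del: binomial_Suc_Suc)
    then have "of_nat (N_truc k * Suc h) = (0 :: bit)"
      by (simp only: Z2.bit_eq_iff even_of_nat_iff even_zero simp_thms)
    then show "of_nat (N_truc k) * of_nat (Suc h) = (0 :: bit)"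
      by (simp only: of_nat_mult)
  qed
  ultimately show ?thesis ..
qed

end
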